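(* Let $K$ be a $2$-dimensional simplicial complex that is an obstruction to shellability. Then $K$ has at most $7$ vertices. In other words, there are no $2$-dimensional obstructions to shellability with more than $7$ vertices.
   Context: All simplicial complexes are finite (abstract) and contain the empty face; if $K$ is a simplicial complex on vertex set $V$, then $\{v\}\in K$ for every $v\in V$. Facets are the inclusion-maximal faces; $\dim F=|F|-1$. A complex is pure if all its facets have the same dimension. For $U\subseteq V$, the induced subcomplex $K(U)$ is $\{F\in K: F\subseteq U\}$; it is proper if $U\subsetneq V$. Shellability means (not necessarily pure) shellability: $K$ is shellable if its facets can be ordered $F_1,\dots,F_t$ so that for each $k=2,\dots,t$ the complex $\left(\bigcup_{i=1}^{k-1}\bar F_i\right)\cap \bar F_k$ is pure of dimension $\dim F_k-1$, where $\bar F$ denotes the simplex consisting of all subsets of $F$. An obstruction to shellability is a nonshellable simplicial complex all of whose proper induced subcomplexes are shellable. *)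

theory Defs
  imports Main
begin

definition simplicial_complex :: "'a set \<Rightarrow> 'a set set \<Rightarrow> bool" where
  "simplicial_complex V K \<longleftrightarrow>
     finite V \<and> K \<subseteq> Pow V \<and> {} \<in> K \<and> (\<forall>v\<in>V. {v} \<in> K) \<and>
     (\<forall>F\<in>K. \<forall>G. G \<subseteq> F \<longrightarrow> G \<in> K)"

(* Integer-valued, so that the empty face has dimension -1. *)
definition face_dim :: "'a set \<Rightarrow> int" where
  "face_dim F = int (card F) - 1"

definition complex_dim :: "'a set set \<Rightarrow> int" where
  "complex_dim K = Max (face_dim ` K)"

definition facets :: "'a set set \<Rightarrow> 'a set set" where
  "facets K = {F \<in> K. \<forall>G\<in>K. F \<subseteq> G \<longrightarrow> G = F}"

definition pure_complex :: "'a set set \<Rightarrow> bool" where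
  "pure_complex K \<longleftrightarrow> (\<forall>F\<in>facets K. \<forall>G\<in>facets K. face_dim F = face_dim G)"

definition induced_subcomplex :: "'a set set \<Rightarrow> 'a set \<Rightarrow> 'a set set" where
  "induced_subcomplex K U = {F \<in> K. F \<subseteq> U}"

(* Nonpure shellability.  The simplex spanned by a facet F is Pow F; the list Fs is indexed
   from 0, so Fs ! 0 is the first facet of the shelling order. *)
definition is_shelling :: "'a set set \<Rightarrow> 'a set list \<Rightarrow> bool" where
  "is_shelling K Fs \<longleftrightarrow>
     distinct Fs \<and> set Fs = facets K \<and>
     (\<forall>k. 1 \<le> k \<and> k < length Fs \<longrightarrow>
        (let L = (\<Union>i<k. Pow (Fs ! i)) \<inter> Pow (Fs ! k)
         in pure_complex L \<and> complex_dim L = face_dim (Fs ! k) - 1))"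

definition shellable :: "'a set set \<Rightarrow> bool" where
  "shellable K \<longleftrightarrow> (\<exists>Fs. is_shelling K Fs)"

definition obstruction_to_shellability :: "'a set \<Rightarrow> 'a set set \<Rightarrow> bool" where
  "obstruction_to_shellability V K \<longleftrightarrow>
     simplicial_complex V K \<and> \<not> shellable K \<and>
     (\<forall>U. U \<subset> V \<longrightarrow> shellable (induced_subcomplex K U))"

end

theory Submission
  imports Defs
begin

text \<open>
  Let \<open>T\<close> be the set of triangles. If \<open>T\<close> minus the star of a vertex \<open>v\<close> is shellable, a shelling
  extends over the star of \<open>v\<close> unless two link vertices \<open>a\<close>, \<open>b\<close>, each lying in a triangle avoiding
  \<open>v\<close>, are separated in the link once its free edges (those in no triangle avoiding \<open>v\<close>) are removed.
  If \<open>{v, a, b}\<close> is itself a triangle, then with triangles \<open>S\<close> containing \<open>a\<close> and \<open>S'\<close> containing \<open>b\<close>,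
  both avoiding \<open>v\<close>, the separation yields a 1-cocycle modulo 2 on the triangles inside \<open>{v} \<union> S \<union> S'\<close>
  that is not a coboundary; so these at most 7 points carry a nonshellable complex. Otherwise the link
  of \<open>v\<close> has a vertex all of whose triangles contain \<open>v\<close>. Repeating the argument there produces a
  twin \<open>x\<close>, lying in exactly the same triangles as \<open>v\<close>, and a triangle \<open>{v, x, a}\<close> with \<open>a\<close> in a triangle
  avoiding \<open>v\<close>; then \<open>a\<close> cannot have a twin, a contradiction. Finally the edge facets can be shelled
  after the triangles, since two disjoint edges never form an induced subcomplex.
\<close>

text \<open>The adjunction condition of a shelling does not depend on the order of the earlier facets, so
  shellings are handled as growing sets of facets; \<open>attaches {} F\<close> holds vacuously for the first one.\<close>

definition attaches :: "'a set set \<Rightarrow> 'a set \<Rightarrow> bool" where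
  "attaches A F \<longleftrightarrow> (\<forall>H\<in>A. \<exists>H'\<in>A. H \<inter> F \<subseteq> H' \<and> card (H' \<inter> F) + 1 = card F)"

inductive shells :: "'a set set \<Rightarrow> bool" where
  shells_empty: "shells {}"
| shells_insert: "shells A \<Longrightarrow> F \<notin> A \<Longrightarrow> attaches A F \<Longrightarrow> shells (insert F A)"

section \<open>Comparison with shelling orders given as lists\<close>

lemma ex_facet_above:
  assumes "finite K" "G \<in> K"
  shows "\<exists>F\<in>facets K. G \<subseteq> F"
proof -
  obtain F where "F \<in> K" "G \<subseteq> F" "\<forall>b\<in>K. F \<subseteq> b \<longrightarrow> F = b"
    using finite_has_maximal2[OF assms] by auto
  then show ?thesis unfolding facets_def by (intro bexI[of _ F]) auto
qed

text \<open>The facets of \<open>L\<close> are the maximal ones among the sets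
  \<open>H \<inter> F\<close>. Purity in codimension one therefore amounts to each such intersection
  lying in one with a single point of \<open>F\<close> missing.\<close>

lemma attaches_iff:
  assumes "finite F" "A \<noteq> {}"
  defines "L \<equiv> (\<Union>H\<in>A. Pow H) \<inter> Pow F"
  shows "pure_complex L \<and> complex_dim L = face_dim F - 1 \<longleftrightarrow> attaches A F"
proof
  have finL: "finite L" unfolding L_def using assms(1) by auto
  have neL: "L \<noteq> {}" unfolding L_def using assms(2) by auto
  show "attaches A F" if L: "pure_complex L \<and> complex_dim L = face_dim F - 1"
    unfolding attaches_def
  proof
    fix H assume "H \<in> A"
    then have "H \<inter> F \<in> L" unfolding L_def by auto
    then obtain G where G: "G \<in> facets L" "H \<inter> F \<subseteq> G" using ex_facet_above[OF finL] by blast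
    \<comment> \<open>The maximal dimension is attained at some face, hence at a facet above it;
      purity then gives every facet, in particular \<open>G\<close>, that dimension.\<close>
    have "Max (face_dim ` L) \<in> face_dim ` L" using finL neL by (intro Max_in) auto
    then obtain M where M: "M \<in> L" "face_dim M = face_dim F - 1"
      using L unfolding complex_dim_def by auto
    obtain M' where M': "M' \<in> facets L" "M \<subseteq> M'" using ex_facet_above[OF finL M(1)] by blast
    have M'L: "M' \<in> L" using M' unfolding facets_def by auto
    have "face_dim M' = face_dim F - 1"
    proof (rule antisym)
      show "face_dim M' \<le> face_dim F - 1"
        using L finL M'L unfolding complex_dim_def by (metis Max_ge finite_imageI imageI)
      have "finite M'" using M'L assms(1) unfolding L_def by (auto intro: finite_subset)
      then show "face_dim F - 1 \<le> face_dim M'"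
        using M M'(2) card_mono[of M' M] unfolding face_dim_def by auto
    qed
    then have dG: "face_dim G = face_dim F - 1" using L G(1) M'(1) unfolding pure_complex_def by metis
    obtain H' where H': "H' \<in> A" "G \<subseteq> H'" "G \<subseteq> F" using G(1) unfolding facets_def L_def by auto
    then have "H' \<inter> F \<in> L" unfolding L_def by auto
    moreover have "\<forall>M\<in>L. G \<subseteq> M \<longrightarrow> M = G" using G(1) by (simp add: facets_def)
    ultimately have "H' \<inter> F = G" using H'(2,3) by simp
    then show "\<exists>H'\<in>A. H \<inter> F \<subseteq> H' \<and> card (H' \<inter> F) + 1 = card F"
      using H' G dG unfolding face_dim_def by auto
  qed
  show "pure_complex L \<and> complex_dim L = face_dim F - 1" if att: "attaches A F"
  proof -
    have key: "\<exists>M\<in>L. G \<subseteq> M \<and> face_dim M = face_dim F - 1" if "G \<in> L" for G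
    proof -
      from that obtain H where H: "H \<in> A" "G \<subseteq> H" "G \<subseteq> F" unfolding L_def by auto
      then obtain H' where "H' \<in> A" "H \<inter> F \<subseteq> H'" "card (H' \<inter> F) + 1 = card F"
        using att unfolding attaches_def by blast
      then show ?thesis using H unfolding L_def face_dim_def
        by (intro bexI[of _ "H' \<inter> F"]) auto
    qed
    have fac: "face_dim G = face_dim F - 1" if "G \<in> facets L" for G
      using key[of G] that unfolding facets_def by auto
    have "Max (face_dim ` L) = face_dim F - 1"
    proof (rule Max_eqI)
      show "finite (face_dim ` L)" using finL by simp
      show "face_dim F - 1 \<in> face_dim ` L" using key neL by force
      fix d assume "d \<in> face_dim ` L"
      then obtain G where G: "G \<in> L" "d = face_dim G" by auto
      obtain M where M: "M \<in> L" "G \<subseteq> M" "face_dim M = face_dim F - 1" using key[OF G(1)] by blast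
      have "finite M" using M(1) assms(1) unfolding L_def by (auto intro: finite_subset)
      then show "d \<le> face_dim F - 1"
        using M G card_mono[of M G] unfolding face_dim_def by auto
    qed
    then show ?thesis using fac unfolding pure_complex_def complex_dim_def by simp
  qed
qed

lemma shells_imp_list:
  assumes "shells A" "\<forall>F\<in>A. finite F"
  shows "\<exists>Fs. distinct Fs \<and> set Fs = A \<and>
    (\<forall>k. 1 \<le> k \<and> k < length Fs \<longrightarrow>
        (let L = (\<Union>i<k. Pow (Fs ! i)) \<inter> Pow (Fs ! k)
         in pure_complex L \<and> complex_dim L = face_dim (Fs ! k) - 1))"
  using assms
proof (induction rule: shells.induct)
  case shells_empty
  then show ?case by simp
next
  case (shells_insert A F)
  then obtain Fs where Fs: "distinct Fs" "set Fs = A"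
    "\<And>k. 1 \<le> k \<Longrightarrow> k < length Fs \<Longrightarrow>
        (let L = (\<Union>i<k. Pow (Fs ! i)) \<inter> Pow (Fs ! k)
         in pure_complex L \<and> complex_dim L = face_dim (Fs ! k) - 1)" by auto
  have "let L = (\<Union>i<k. Pow ((Fs @ [F]) ! i)) \<inter> Pow ((Fs @ [F]) ! k)
         in pure_complex L \<and> complex_dim L = face_dim ((Fs @ [F]) ! k) - 1"
    if k: "1 \<le> k" "k < length (Fs @ [F])" for k
  proof (cases "k < length Fs")
    case True
    then have "(\<Union>i<k. Pow ((Fs @ [F]) ! i)) = (\<Union>i<k. Pow (Fs ! i))"
      by (auto simp: nth_append)
    then show ?thesis using Fs(3)[OF k(1) True] True by (simp add: nth_append)
  next
    case False
    then have kl: "k = length Fs" using k by simp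
    have "(\<Union>i<k. Pow ((Fs @ [F]) ! i)) = (\<Union>H\<in>A. Pow H)"
      unfolding kl Fs(2)[symmetric] set_conv_nth by (auto simp: nth_append)
    moreover have "A \<noteq> {}" using Fs(2) kl k(1) by auto
    ultimately show ?thesis
      using attaches_iff[of F A] shells_insert kl by (simp add: Let_def)
  qed
  then show ?case using Fs shells_insert by (intro exI[of _ "Fs @ [F]"]) auto
qed

lemma is_shelling_imp_shells:
  assumes "is_shelling K Fs" "\<forall>F\<in>K. finite F" "n \<le> length Fs"
  shows "shells (set (take n Fs))"
  using assms(3)
proof (induction n)
  case 0
  then show ?case by (simp add: shells_empty)
next
  case (Suc n)
  then have n: "n < length Fs" by simp
  have F: "distinct Fs" "set Fs = facets K" using assms unfolding is_shelling_def by auto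
  have notin: "Fs ! n \<notin> set (take n Fs)"
    using F(1) n by (metis distinct_take id_take_nth_drop not_distinct_conv_prefix take_Suc_conv_app_nth)
  have un: "(\<Union>i<n. Pow (Fs ! i)) = (\<Union>H\<in>set (take n Fs). Pow H)"
    using n by (simp add: nth_image[symmetric] lessThan_atLeast0)
  have fin: "finite (Fs ! n)" using F(2) n assms(2) nth_mem unfolding facets_def by blast
  have "attaches (set (take n Fs)) (Fs ! n)"
  proof (cases n)
    case 0
    then show ?thesis by (simp add: attaches_def)
  next
    case (Suc m)
    then have "set (take n Fs) \<noteq> {}" using n by auto
    then show ?thesis
      using attaches_iff[OF fin] assms(1) n Suc un unfolding is_shelling_def Let_def
      by (metis le_add1 plus_1_eq_Suc)
  qed
  then show ?case
    using shells_insert[OF Suc.IH notin] n by (simp add: take_Suc_conv_app_nth)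
qed

lemma shellable_iff_shells:
  assumes "\<forall>F\<in>K. finite F"
  shows "shellable K \<longleftrightarrow> shells (facets K)"
proof
  assume "shellable K"
  then obtain Fs where "is_shelling K Fs" unfolding shellable_def by auto
  then show "shells (facets K)"
    using is_shelling_imp_shells[of K Fs "length Fs"] assms unfolding is_shelling_def by simp
next
  assume "shells (facets K)"
  then show "shellable K"
    using shells_imp_list[of "facets K"] assms unfolding shellable_def is_shelling_def facets_def
    by auto
qed

section \<open>What a shelling forces: connectivity and vanishing cohomology\<close>

text \<open>When a facet with \<open>d + 1\<close> points is attached, the witness \<open>H'\<close>
  shares \<open>d\<close> points with it and, by the antichain condition, has a further point
  outside. So \<open>H'\<close> is itself top-dimensional and survives the restriction.\<close>

lemma shells_top_dimensional:
  assumes "shells A" "\<forall>F\<in>A. finite F \<and> card F \<le> Suc d" "\<forall>F\<in>A. \<forall>G\<in>A. F \<subseteq> G \<longrightarrow> F = G"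
  shows "shells {F\<in>A. card F = Suc d}"
  using assms
proof (induction rule: shells.induct)
  case shells_empty
  then show ?case by (simp add: shells.shells_empty)
next
  case (shells_insert A F)
  let ?A = "{F\<in>A. card F = Suc d}"
  have IH: "shells ?A" using shells_insert by simp
  show ?case
  proof (cases "card F = Suc d")
    case False
    then have "{G\<in>insert F A. card G = Suc d} = ?A" by auto
    then show ?thesis using IH by simp
  next
    case True
    have "attaches ?A F" unfolding attaches_def
    proof
      fix H assume "H \<in> ?A"
      then obtain H' where H': "H' \<in> A" "H \<inter> F \<subseteq> H'" "card (H' \<inter> F) + 1 = card F"
        using shells_insert.hyps unfolding attaches_def by blast
      have fH': "finite H'" "card H' \<le> Suc d" using shells_insert.prems H' by auto
      have "\<not> H' \<subseteq> F" using shells_insert.prems(2) H'(1) shells_insert.hyps(2) by blast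
      then have "card (H' \<inter> F) < card H'" using fH' by (intro psubset_card_mono) auto
      then have "card H' = Suc d" using H' True fH' by simp
      then show "\<exists>H'\<in>?A. H \<inter> F \<subseteq> H' \<and> card (H' \<inter> F) + 1 = card F" using H' by auto
    qed
    moreover have "{G\<in>insert F A. card G = Suc d} = insert F ?A" using True by auto
    ultimately show ?thesis using IH shells.shells_insert[of ?A F] shells_insert.hyps by simp
  qed
qed

text \<open>Connectedness without paths: a set \<open>X\<close> that no facet crosses is a union of
  components. A facet with at least two points is attached along a nonempty face, so it lies on the
  same side of \<open>X\<close> as its predecessors.\<close>

lemma shells_connected:
  assumes "shells A" "\<forall>F\<in>A. 2 \<le> card F" "\<forall>F\<in>A. F \<subseteq> X \<or> F \<inter> X = {}"
  shows "(\<forall>F\<in>A. F \<subseteq> X) \<or> (\<forall>F\<in>A. F \<inter> X = {})"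
  using assms
proof (induction rule: shells.induct)
  case shells_empty
  then show ?case by simp
next
  case (shells_insert A F)
  show ?case
  proof (cases "A = {}")
    case True
    then show ?thesis using shells_insert.prems by auto
  next
    case False
    then obtain H where H: "H \<in> A" "card (H \<inter> F) + 1 = card F"
      using shells_insert.hyps unfolding attaches_def by blast
    then have "card (H \<inter> F) \<noteq> 0" using shells_insert.prems by auto
    then obtain y where "y \<in> H" "y \<in> F" by (metis card.empty disjoint_iff)
    moreover have "(\<forall>F\<in>A. F \<subseteq> X) \<or> (\<forall>F\<in>A. F \<inter> X = {})" using shells_insert by simp
    ultimately show ?thesis using H(1) shells_insert.prems(2) by blast
  qed
qed

text \<open>The same argument in the link of \<open>v\<close>: a triangle through \<open>v\<close>
  that is not the first such one shares with an earlier one an edge containing \<open>v\<close>,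
  that is, a vertex of the link.\<close>

lemma shells_link_connected:
  assumes "shells A" "\<forall>F\<in>A. card F = 3"
    and "\<forall>F\<in>A. v \<in> F \<longrightarrow> F - {v} \<subseteq> X \<or> (F - {v}) \<inter> X = {}"
  shows "(\<forall>F\<in>A. v \<in> F \<longrightarrow> F - {v} \<subseteq> X) \<or> (\<forall>F\<in>A. v \<in> F \<longrightarrow> (F - {v}) \<inter> X = {})"
  using assms
proof (induction rule: shells.induct)
  case shells_empty
  then show ?case by simp
next
  case (shells_insert A F)
  have IH: "(\<forall>F\<in>A. v \<in> F \<longrightarrow> F - {v} \<subseteq> X) \<or> (\<forall>F\<in>A. v \<in> F \<longrightarrow> (F - {v}) \<inter> X = {})"
    using shells_insert by simp
  show ?case
  proof (cases "v \<in> F \<and> (\<exists>H\<in>A. v \<in> H)")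
    case False
    then show ?thesis using IH shells_insert.prems by auto
  next
    case True
    then obtain H where "H \<in> A" "v \<in> H" by blast
    \<comment> \<open>Since \<open>v\<close> lies in \<open>H \<inter> F\<close>, the
      codimension-one witness covering this intersection contains \<open>v\<close> too.\<close>
    then obtain H' where H': "H' \<in> A" "v \<in> H'" "card (H' \<inter> F) + 1 = card F"
      using shells_insert.hyps True unfolding attaches_def by blast
    then have "card (H' \<inter> F) = 2" using shells_insert.prems by simp
    then have "\<not> H' \<inter> F \<subseteq> {v}" using card_mono[of "{v}" "H' \<inter> F"] by auto
    then obtain y where "y \<in> H'" "y \<in> F" "y \<noteq> v" by blast
    then show ?thesis using IH H' True shells_insert.prems(2) by blast
  qed
qed

text \<open>A shellable complex of triangles has vanishing first cohomology over the field with two elements.\<close>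

lemma shells_cocycle_is_coboundary:
  fixes f :: "'a set \<Rightarrow> bool"
  assumes "shells A" "\<forall>F\<in>A. card F = 3"
    and "\<forall>x y z. {x, y, z} \<in> A \<longrightarrow> f {x, z} = (f {x, y} \<noteq> f {y, z})"
  shows "\<exists>g :: 'a \<Rightarrow> bool. \<forall>F\<in>A. \<forall>x\<in>F. \<forall>y\<in>F. x \<noteq> y \<longrightarrow> f {x, y} = (g x \<noteq> g y)"
  using assms
proof (induction rule: shells.induct)
  case shells_empty
  then show ?case by simp
next
  case (shells_insert A F)
  have "\<exists>g :: 'a \<Rightarrow> bool. \<forall>F\<in>A. \<forall>x\<in>F. \<forall>y\<in>F. x \<noteq> y \<longrightarrow> f {x, y} = (g x \<noteq> g y)"
    by (rule shells_insert.IH) (use shells_insert.prems in blast)+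
  then obtain g :: "'a \<Rightarrow> bool" where g0: "\<forall>F\<in>A. \<forall>x\<in>F. \<forall>y\<in>F. x \<noteq> y \<longrightarrow> f {x, y} = (g x \<noteq> g y)" ..
  have g: "f {x, y} = (g x \<noteq> g y)" if "H \<in> A" "x \<in> H" "y \<in> H" "x \<noteq> y" for H x y
    using g0 that by blast
  have cF: "card F = 3" using shells_insert.prems by simp
  \<comment> \<open>If \<open>z\<close> is a new vertex, its value is free: it is chosen to fit the
    edge \<open>{x, z}\<close>, and the cocycle equation settles \<open>{y, z}\<close>.\<close>
  have extend: ?case if xyz: "F = {x, y, z}" "x \<noteq> y" "x \<noteq> z" "y \<noteq> z"
    and new: "z \<notin> \<Union>A" and h: "f {x, y} = (h x \<noteq> h y)"
      "\<And>H x y. H \<in> A \<Longrightarrow> x \<in> H \<Longrightarrow> y \<in> H \<Longrightarrow> x \<noteq> y \<Longrightarrow> f {x, y} = (h x \<noteq> h y)" for x y z and h :: "'a \<Rightarrow> bool"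
  proof -
    let ?h = "h(z := (h x \<noteq> f {x, z}))"
    have "f {x, z} = (f {x, y} \<noteq> f {y, z})" using shells_insert.prems(2) xyz by blast
    then have "\<forall>a\<in>F. \<forall>b\<in>F. a \<noteq> b \<longrightarrow> f {a, b} = (?h a \<noteq> ?h b)"
      using xyz h(1) by (auto simp: insert_commute)
    moreover have "\<forall>H\<in>A. \<forall>a\<in>H. \<forall>b\<in>H. a \<noteq> b \<longrightarrow> f {a, b} = (?h a \<noteq> ?h b)"
      using new h(2) by auto
    ultimately show ?thesis by (intro exI[of _ ?h]) simp
  qed
  show ?case
  proof (cases "A = {}")
    case True
    obtain x y z where xyz: "F = {x, y, z}" "x \<noteq> y" "x \<noteq> z" "y \<noteq> z"
      using cF by (auto simp: card_3_iff)
    show ?thesis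
      \<comment> \<open>For the first triangle the potential starts with False at \<open>x\<close>
        and \<open>f {x, y}\<close> at \<open>y\<close>.\<close>
      by (rule extend[OF xyz, of "\<lambda>u. u = y \<and> f {x, y}"]) (use True xyz in auto)
  next
    case False
    then obtain H where H: "H \<in> A" "card (H \<inter> F) = 2"
      using shells_insert.hyps cF unfolding attaches_def by fastforce
    then obtain x y where xy: "H \<inter> F = {x, y}" "x \<noteq> y" by (auto simp: card_2_iff)
    have "card (F - {x, y}) = 1" using cF xy by (subst card_Diff_subset) auto
    then obtain z where "F - {x, y} = {z}" by (auto simp: card_1_singleton_iff)
    then have xyz: "F = {x, y, z}" "x \<noteq> z" "y \<noteq> z" using xy by auto
    have fxy: "f {x, y} = (g x \<noteq> g y)" using g[OF H(1) _ _ xy(2)] xy(1) by auto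
    show ?thesis
    proof (cases "z \<in> \<Union>A")
      case False
      show ?thesis by (rule extend[OF xyz(1) xy(2) xyz(2,3) False, of g, OF fxy g])
    next
      case True
      then obtain M where M: "M \<in> A" "z \<in> M" by blast
      \<comment> \<open>If \<open>z\<close> is not new, some earlier triangle shares with
        \<open>F\<close> an edge through \<open>z\<close>. Then \<open>g\<close> already fits two
        edges of \<open>F\<close>, and the cocycle equation gives the third.\<close>
      then obtain H' where H': "H' \<in> A" "z \<in> H'" "card (H' \<inter> F) = 2"
        using shells_insert.hyps(3) cF xyz(1) unfolding attaches_def by fastforce
      have "x \<in> H' \<or> y \<in> H'"
      proof (rule ccontr)
        assume "\<not> ?thesis"
        then have "H' \<inter> F = {z}" using H' xyz by auto
        then show False using H' by simp
      qed
      then have "f {x, z} = (g x \<noteq> g z) \<or> f {y, z} = (g y \<noteq> g z)"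
        using g[OF H'(1)] H'(2) xyz by metis
      moreover have "f {x, z} = (f {x, y} \<noteq> f {y, z})" using shells_insert.prems(2) xyz by blast
      ultimately have "\<forall>a\<in>F. \<forall>b\<in>F. a \<noteq> b \<longrightarrow> f {a, b} = (g a \<noteq> g b)"
        using xyz xy(2) fxy by (auto simp: insert_commute)
      then show ?thesis using g0 by (intro exI[of _ g]) simp
    qed
  qed
qed

section \<open>Extending a shelling over the star of a vertex\<close>

text \<open>A greedy choice replaces explicit orderings: once \<open>C\<close> is maximal, all of
  \<open>B\<close> has been placed as soon as every leftover facet is shown to attach.\<close>

lemma obtain_maximal_shells:
  assumes "finite B" "shells (A \<union> C0)" "C0 \<subseteq> B"
  obtains C where "C0 \<subseteq> C" "C \<subseteq> B" "shells (A \<union> C)"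
    "\<And>F. F \<in> B \<Longrightarrow> F \<notin> A \<union> C \<Longrightarrow> \<not> attaches (A \<union> C) F"
proof -
  let ?S = "{C. C0 \<subseteq> C \<and> C \<subseteq> B \<and> shells (A \<union> C)}"
  have "finite ?S" by (rule finite_subset[of _ "Pow B"]) (use assms(1) in auto)
  moreover have "C0 \<in> ?S" using assms by simp
  ultimately obtain C where C: "C \<in> ?S" "\<forall>D\<in>?S. C \<subseteq> D \<longrightarrow> C = D"
    using finite_has_maximal2[of ?S C0] by auto
  have "\<not> attaches (A \<union> C) F" if F: "F \<in> B" "F \<notin> A \<union> C" for F
  proof
    assume "attaches (A \<union> C) F"
    then have "shells (A \<union> insert F C)" using shells_insert[of "A \<union> C" F] C(1) F by simp
    then have "insert F C \<in> ?S" using C(1) F by auto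
    from bspec[OF C(2) this] have "C = insert F C" by blast
    then show False using F by blast
  qed
  then show thesis using that C(1) by blast
qed

lemma card_inter_eq_2:
  assumes "card F = 3" "card H = 3" "H \<noteq> F" "v \<in> H" "v \<in> F" "y \<in> H" "y \<in> F" "y \<noteq> v"
  shows "card (H \<inter> F) = 2"
proof -
  have fin: "finite F" "finite H" using assms by (auto intro: card_ge_0_finite)
  have "H \<inter> F \<noteq> F"
    using card_subset_eq[of H F] fin assms by auto
  then have "card (H \<inter> F) < 3" using psubset_card_mono[of F "H \<inter> F"] fin assms(1) by auto
  moreover have "card {v, y} \<le> card (H \<inter> F)" using fin assms by (intro card_mono) auto
  ultimately show ?thesis using assms(8) by simp
qed

lemma star_inter:
  assumes "card H = 3" "card F = 3" "v \<in> H" "v \<in> F" "H \<noteq> F"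
  shows "H \<inter> F = {v} \<or> card (H \<inter> F) = 2"
proof (cases "H \<inter> F \<subseteq> {v}")
  case True
  then show ?thesis using assms by auto
next
  case False
  then obtain y where "y \<in> H" "y \<in> F" "y \<noteq> v" by blast
  then show ?thesis using card_inter_eq_2[of F H v y] assms by simp
qed

text \<open>A triangle avoiding \<open>v\<close> meets \<open>F\<close> inside the edge
  \<open>F - {v}\<close>, which \<open>S\<close> covers. A triangle of \<open>C\<close> meets
  \<open>F\<close> in an edge or only in \<open>v\<close>; the latter is covered by a member of
  \<open>C\<close> sharing a link vertex with \<open>F\<close>.\<close>

lemma attaches_star_good:
  assumes "\<forall>H\<in>insert F (A \<union> C). card H = 3" "\<forall>H\<in>A. v \<notin> H" "\<forall>H\<in>insert F C. v \<in> H" "F \<notin> C"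
    and "S \<in> A" "F - {v} \<subseteq> S" "C = {} \<or> (F - {v}) \<inter> \<Union>C \<noteq> {}"
  shows "attaches (A \<union> C) F"
  unfolding attaches_def
proof
  fix H assume H: "H \<in> A \<union> C"
  have S: "S \<inter> F = F - {v}" using assms by auto
  have "card (S \<inter> F) + 1 = card F" using assms(1,3) unfolding S by simp
  moreover have cF: "card F = 3" using assms(1) by simp
  ultimately have S2: "card (S \<inter> F) + 1 = card F" "card F = 3" by auto
  show "\<exists>H'\<in>A \<union> C. H \<inter> F \<subseteq> H' \<and> card (H' \<inter> F) + 1 = card F"
  proof (cases "v \<in> H")
    case False
    then have "H \<inter> F \<subseteq> S" using S by auto
    then show ?thesis using S2 assms(5) by blast
  next
    case True
    then have HC: "H \<in> C" using H assms(2) by auto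
    then obtain y H' where y: "y \<in> F" "y \<noteq> v" "H' \<in> C" "y \<in> H'" using assms(7) by auto
    have H': "card (H' \<inter> F) = 2" "v \<in> H'" using card_inter_eq_2[of F H' v y] y assms(1,3,4) by auto
    have "H \<inter> F = {v} \<or> card (H \<inter> F) = 2"
      using star_inter[of H F v] HC assms(1,3,4) by auto
    then show ?thesis
    proof
      assume "H \<inter> F = {v}"
      then show ?thesis using H' y(3) cF by (intro bexI[of _ H']) auto
    next
      assume "card (H \<inter> F) = 2"
      then show ?thesis using H cF by (intro bexI[of _ H]) auto
    qed
  qed
qed

text \<open>When \<open>F - {v}\<close> is free, a triangle of \<open>A\<close> meets
  \<open>F\<close> in at most one point. That point already lies in a triangle of \<open>C\<close>,
  which shares with \<open>F\<close> the edge joining it to \<open>v\<close>.\<close>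

lemma attaches_star_free:
  assumes "\<forall>H\<in>insert F (A \<union> C). card H = 3" "\<forall>H\<in>A. v \<notin> H" "\<forall>H\<in>insert F C. v \<in> H" "F \<notin> C"
    and "\<not> (\<exists>S\<in>A. F - {v} \<subseteq> S)" "(F - {v}) \<inter> \<Union>A \<subseteq> \<Union>C"
    and "(A = {} \<and> C = {}) \<or> (F - {v}) \<inter> \<Union>C \<noteq> {}"
  shows "attaches (A \<union> C) F"
  unfolding attaches_def
proof
  fix H assume H: "H \<in> A \<union> C"
  have cF: "card F = 3" using assms(1) by simp
  have via: "\<exists>H'\<in>C. v \<in> H' \<and> y \<in> H' \<and> card (H' \<inter> F) = 2" if y: "y \<in> F" "y \<noteq> v" "y \<in> \<Union>C" for y
  proof -
    obtain H' where "H' \<in> C" "y \<in> H'" using y(3) by blast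
    then show ?thesis using y assms(1,3,4) card_inter_eq_2[of F H' v y] by (intro bexI[of _ H']) auto
  qed
  \<comment> \<open>Unless \<open>H\<close> itself meets \<open>F\<close> in an edge, the edge
    \<open>{v, y}\<close> is the face along which \<open>H \<inter> F\<close> gets covered.\<close>
  obtain y where y: "y \<in> F - {v}" "y \<in> \<Union>C" "H \<inter> F \<subseteq> {v, y} \<or> card (H \<inter> F) = 2"
  proof (cases "v \<in> H")
    case True
    obtain y where "y \<in> F - {v}" "y \<in> \<Union>C" using assms(7) H by blast
    moreover have "H \<in> C" using True H assms(2) by auto
    then have "H \<inter> F = {v} \<or> card (H \<inter> F) = 2"
      using star_inter[of H F v] assms(1,3,4) by auto
    ultimately show ?thesis using that by blast
  next
    case False
    then have HA: "H \<in> A" using H assms(3) by auto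
    show ?thesis
    proof (cases "H \<inter> F = {}")
      case True
      then show ?thesis using that assms(7) H by blast
    next
      case nonempty: False
      then obtain y where y: "y \<in> H" "y \<in> F" by blast
      then have yv: "y \<in> F - {v}" "y \<in> \<Union>C" using False HA assms(6) by blast+
      obtain z where z: "F = {v, y, z}"
      proof -
        have "v \<in> F" using assms(3) by simp
        then have "card (F - {v, y}) = 1" using cF y(2) yv(1) by (subst card_Diff_subset) auto
        then obtain z where "F - {v, y} = {z}" by (auto simp: card_1_singleton_iff)
        then show thesis using that[of z] \<open>v \<in> F\<close> y(2) by blast
      qed
      have "\<not> F - {v} \<subseteq> H" using assms(5) HA by blast
      then have "H \<inter> F \<subseteq> {v, y}" using z y(1) by blast
      then show ?thesis using that yv by blast
    qed
  qed
  then obtain H' where H': "H' \<in> C" "v \<in> H'" "y \<in> H'" "card (H' \<inter> F) = 2"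
    using via y(1,2) by blast
  then show "\<exists>H'\<in>A \<union> C. H \<inter> F \<subseteq> H' \<and> card (H' \<inter> F) + 1 = card F"
  proof (cases "card (H \<inter> F) = 2")
    case True
    then show ?thesis using H cF by (intro bexI[of _ H]) auto
  next
    case False
    then show ?thesis using y(3) cF H' by (intro bexI[of _ H']) auto
  qed
qed

text \<open>The name refers to the order of construction: the triangles avoiding \<open>v\<close>
  are placed before the star of \<open>v\<close>.\<close>

definition old :: "'a set set \<Rightarrow> 'a \<Rightarrow> 'a \<Rightarrow> bool" where
  "old T v y \<longleftrightarrow> (\<exists>F\<in>T. v \<notin> F \<and> y \<in> F)"

text \<open>For \<open>F\<close> through \<open>v\<close>, this fails exactly when the link edge
  \<open>F - {v}\<close> is free.\<close>

definition good :: "'a set set \<Rightarrow> 'a \<Rightarrow> 'a set \<Rightarrow> bool" where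
  "good T v F \<longleftrightarrow> (\<exists>S\<in>T. v \<notin> S \<and> F - {v} \<subseteq> S)"

text \<open>The star of \<open>v\<close> is added in two greedy rounds, first the good triangles,
  then the free ones. By \<open>oldconn\<close> the first round cannot stop early and leaves every
  old link vertex covered; from then on a free triangle attaches as soon as it touches the placed
  part of the link, and \<open>link\<close> carries the second round to the end.\<close>

lemma shells_extend_star:
  assumes fin: "finite T" and card3: "\<forall>F\<in>T. card F = 3"
    and del: "shells {F\<in>T. v \<notin> F}"
    and link: "\<And>X. (\<forall>F\<in>T. v \<in> F \<longrightarrow> F - {v} \<subseteq> X \<or> (F - {v}) \<inter> X = {}) \<Longrightarrow>
      (\<forall>F\<in>T. v \<in> F \<longrightarrow> F - {v} \<subseteq> X) \<or> (\<forall>F\<in>T. v \<in> F \<longrightarrow> (F - {v}) \<inter> X = {})"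
    and oldconn: "\<And>X. (\<forall>F\<in>T. v \<in> F \<and> good T v F \<longrightarrow> F - {v} \<subseteq> X \<or> (F - {v}) \<inter> X = {}) \<Longrightarrow>
      (\<forall>F\<in>T. v \<in> F \<longrightarrow> (\<forall>y\<in>F - {v}. old T v y \<longrightarrow> y \<in> X)) \<or>
      (\<forall>F\<in>T. v \<in> F \<longrightarrow> (\<forall>y\<in>F - {v}. old T v y \<longrightarrow> y \<notin> X))"
    and ex_good: "\<And>S F. S \<in> T \<Longrightarrow> v \<notin> S \<Longrightarrow> F \<in> T \<Longrightarrow> v \<in> F \<Longrightarrow> \<exists>G\<in>T. v \<in> G \<and> good T v G"
  shows "shells T"
proof -
  define A where "A = {F\<in>T. v \<notin> F}"
  define B where "B = {F\<in>T. v \<in> F}"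
  define Bg where "Bg = {F\<in>B. good T v F}"
  have T: "T = A \<union> B" unfolding A_def B_def by auto
  have finB: "finite B" "finite Bg" using fin unfolding Bg_def B_def by auto
  have ne: "F - {v} \<noteq> {}" if "F \<in> B" for F
    using that card3 card_mono[of "{v}" F] unfolding B_def by auto
  have goodA: "good T v F \<longleftrightarrow> (\<exists>S\<in>A. F - {v} \<subseteq> S)" for F unfolding good_def A_def by auto
  have oldA: "old T v y \<longleftrightarrow> y \<in> \<Union>A" for y unfolding old_def A_def by auto
  obtain C where C: "C \<subseteq> Bg" "shells (A \<union> C)"
    "\<And>F. F \<in> Bg \<Longrightarrow> F \<notin> A \<union> C \<Longrightarrow> \<not> attaches (A \<union> C) F"
    using obtain_maximal_shells[of Bg A "{}"] finB del unfolding A_def by auto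
  have disj: "C \<noteq> {} \<and> (F - {v}) \<inter> \<Union>C = {}" if F: "F \<in> Bg" "F \<notin> C" for F
  proof (rule ccontr)
    assume n: "\<not> ?thesis"
    obtain S where S: "S \<in> A" "F - {v} \<subseteq> S" using F goodA unfolding Bg_def by auto
    have "attaches (A \<union> C) F"
      by (rule attaches_star_good[OF _ _ _ F(2) S])
        (use C(1) F n card3 in \<open>auto simp: A_def B_def Bg_def\<close>)
    moreover have "F \<notin> A" using F unfolding A_def B_def Bg_def by simp
    ultimately show False using C(3) F by blast
  qed
  have CBg: "C = Bg"
  proof (rule ccontr)
    assume "C \<noteq> Bg"
    then obtain F where F: "F \<in> Bg" "F \<notin> C" using C(1) by blast
    then obtain G where G: "G \<in> C" using disj by blast
    \<comment> \<open>If the first round stopped early, the placed part would separate old vertices: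
      both ends of a good link edge are old, with \<open>G\<close> inside and \<open>F\<close>
      outside.\<close>
    have "\<forall>F\<in>T. v \<in> F \<and> good T v F \<longrightarrow> F - {v} \<subseteq> \<Union>C \<or> (F - {v}) \<inter> \<Union>C = {}"
      using disj unfolding Bg_def B_def by blast
    from oldconn[OF this] have
      "(\<forall>F\<in>B. \<forall>y\<in>F - {v}. old T v y \<longrightarrow> y \<in> \<Union>C) \<or> (\<forall>F\<in>B. \<forall>y\<in>F - {v}. old T v y \<longrightarrow> y \<notin> \<Union>C)"
      unfolding B_def by blast
    moreover have oldF: "\<forall>y\<in>F - {v}. old T v y" if "F \<in> Bg" for F
      using that goodA oldA unfolding Bg_def by blast
    moreover have "G \<in> Bg" "G \<in> B" "F \<in> B" using G F C(1) unfolding Bg_def by auto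
    moreover obtain y where "y \<in> G - {v}" using ne[OF \<open>G \<in> B\<close>] by blast
    moreover obtain z where "z \<in> F - {v}" using ne[OF \<open>F \<in> B\<close>] by blast
    ultimately have "z \<in> \<Union>C \<or> y \<notin> \<Union>C" using F(1) by blast
    moreover have "y \<in> \<Union>C" using G \<open>y \<in> G - {v}\<close> by blast
    moreover have "z \<notin> \<Union>C" using disj[OF F] \<open>z \<in> F - {v}\<close> by blast
    ultimately show False by blast
  qed
  obtain D where D: "Bg \<subseteq> D" "D \<subseteq> B" "shells (A \<union> D)"
    "\<And>F. F \<in> B \<Longrightarrow> F \<notin> A \<union> D \<Longrightarrow> \<not> attaches (A \<union> D) F"
    using obtain_maximal_shells[of B A Bg] finB C CBg Bg_def by auto
  have oldD: "y \<in> \<Union>D" if y: "F \<in> B" "y \<in> F - {v}" "old T v y" for F y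
  proof -
    have A: "A \<noteq> {}" using y(3) oldA by auto
    then obtain G where G: "G \<in> Bg"
      using ex_good y(1) unfolding A_def B_def Bg_def by blast
    then have GB: "G \<in> B" unfolding Bg_def by auto
    obtain z where z: "z \<in> G - {v}" using ne[OF GB] by blast
    have zold: "old T v z" using G z goodA oldA unfolding Bg_def by blast
    \<comment> \<open>\<open>\<Union>Bg\<close> contains the old vertex \<open>z\<close>, so
      \<open>oldconn\<close> puts every old link vertex into it.\<close>
    have "\<forall>F\<in>T. v \<in> F \<and> good T v F \<longrightarrow> F - {v} \<subseteq> \<Union>Bg \<or> (F - {v}) \<inter> \<Union>Bg = {}"
      unfolding Bg_def B_def by blast
    from oldconn[OF this] have "y \<in> \<Union>Bg"
      using y GB G z zold unfolding B_def by blast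
    then show ?thesis using D(1) by blast
  qed
  have disjD: "D \<noteq> {} \<and> (F - {v}) \<inter> \<Union>D = {}" if F: "F \<in> B" "F \<notin> D" for F
  proof (rule ccontr)
    assume n: "\<not> ?thesis"
    have "D = {} \<Longrightarrow> A = {}" using D(1) ex_good F unfolding A_def B_def Bg_def by blast
    have "\<not> (\<exists>S\<in>A. F - {v} \<subseteq> S)" using F D(1) goodA unfolding Bg_def by blast
    moreover have "(F - {v}) \<inter> \<Union>A \<subseteq> \<Union>D" using oldD F(1) oldA by blast
    moreover have "(A = {} \<and> D = {}) \<or> (F - {v}) \<inter> \<Union>D \<noteq> {}"
      using n \<open>D = {} \<Longrightarrow> A = {}\<close> by blast
    ultimately have "attaches (A \<union> D) F"
      using attaches_star_free[of F A D v] F D(2) card3 unfolding A_def B_def by blast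
    moreover have "F \<notin> A" using F unfolding A_def B_def by simp
    ultimately show False using D(4) F by blast
  qed
  have "D = B"
  proof (rule ccontr)
    assume "D \<noteq> B"
    then obtain F where F: "F \<in> B" "F \<notin> D" using D(2) by blast
    then obtain G where G: "G \<in> D" "G \<in> B" using disjD D(2) by blast
    have "\<forall>F\<in>T. v \<in> F \<longrightarrow> F - {v} \<subseteq> \<Union>D \<or> (F - {v}) \<inter> \<Union>D = {}"
      using disjD unfolding B_def by blast
    from link[OF this]
    have "(\<forall>F\<in>B. F - {v} \<subseteq> \<Union>D) \<or> (\<forall>F\<in>B. (F - {v}) \<inter> \<Union>D = {})" unfolding B_def by blast
    then show False using ne[OF F(1)] ne[OF G(2)] disjD[OF F] F G by blast
  qed
  then show ?thesis using D(3) T by simp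
qed

section \<open>Triangle systems that are shellable on seven points\<close>

text \<open>Models the triangles of a supposed obstruction with at least eight vertices: there, sets
  of at most seven vertices and complements of single vertices are proper.\<close>

locale locally_shellable =
  fixes T :: "'a set set"
  assumes fin: "finite T"
    and card3: "F \<in> T \<Longrightarrow> card F = 3"
    and small: "finite U \<Longrightarrow> card U \<le> 7 \<Longrightarrow> shells {F\<in>T. F \<subseteq> U}"
    and del: "v \<in> \<Union>T \<Longrightarrow> shells {F\<in>T. v \<notin> F}"
begin

lemma finite_face: "F \<in> T \<Longrightarrow> finite F"
  by (rule card_ge_0_finite) (simp add: card3)

lemma ex_other:
  assumes "F \<in> T"
  shows "F - {v} \<noteq> {}"
proof
  assume "F - {v} = {}"
  then have "card F \<le> card {v}" by (intro card_mono) auto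
  then show False using card3[OF assms] by simp
qed

lemma face_eq:
  assumes "F \<in> T" "x \<in> F" "y \<in> F" "z \<in> F" "x \<noteq> y" "x \<noteq> z" "y \<noteq> z"
  shows "F = {x, y, z}"
  by (rule card_subset_eq[symmetric]) (use assms card3 finite_face in auto)

lemma face_distinct:
  assumes "{x, y, z} \<in> T"
  shows "x \<noteq> y \<and> x \<noteq> z \<and> y \<noteq> z"
  using card3[OF assms] by (auto simp: card_insert_if split: if_splits)

text \<open>Two link edges witnessing a separation span, together with \<open>v\<close>, at most six
  points, where shellability already makes the link connected.\<close>

lemma link_connected:
  assumes "\<forall>F\<in>T. v \<in> F \<longrightarrow> F - {v} \<subseteq> X \<or> (F - {v}) \<inter> X = {}"
  shows "(\<forall>F\<in>T. v \<in> F \<longrightarrow> F - {v} \<subseteq> X) \<or> (\<forall>F\<in>T. v \<in> F \<longrightarrow> (F - {v}) \<inter> X = {})"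
proof (rule ccontr)
  assume "\<not> ?thesis"
  then obtain F G where FG: "F \<in> T" "v \<in> F" "\<not> F - {v} \<subseteq> X" "G \<in> T" "v \<in> G" "(G - {v}) \<inter> X \<noteq> {}"
    by blast
  have "card (F \<union> G) \<le> 7" using card_Un_le[of F G] card3 FG by simp
  then have "shells {H\<in>T. H \<subseteq> F \<union> G}" using small finite_face FG by simp
  from shells_link_connected[OF this, of v X] assms
  have "(\<forall>H\<in>{H\<in>T. H \<subseteq> F \<union> G}. v \<in> H \<longrightarrow> H - {v} \<subseteq> X) \<or>
    (\<forall>H\<in>{H\<in>T. H \<subseteq> F \<union> G}. v \<in> H \<longrightarrow> (H - {v}) \<inter> X = {})" using card3 by simp
  then show False using FG by auto
qed

text \<open>Without good triangles, the star of \<open>v\<close> shares no edge with a triangle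
  avoiding \<open>v\<close>. A shared vertex \<open>a\<close> would then have a disconnected link,
  so nothing is shared, and \<open>F \<union> S\<close> carries a disconnected system on at most six
  points.\<close>

lemma ex_good:
  assumes "S \<in> T" "v \<notin> S" "F \<in> T" "v \<in> F"
  shows "\<exists>G\<in>T. v \<in> G \<and> good T v G"
proof (rule ccontr)
  assume no: "\<not> ?thesis"
  have no_edge: False if "G \<in> T" "v \<in> G" "H \<in> T" "v \<notin> H" "a \<in> G" "y \<in> G" "a \<in> H" "y \<in> H" "y \<noteq> a" for G H a y
  proof -
    have "G = {v, a, y}" by (rule face_eq) (use that in auto)
    then have "good T v G" unfolding good_def using that by auto
    then show False using no that by blast
  qed
  have disj: "a \<notin> H" if G: "G \<in> T" "v \<in> G" "a \<in> G" and H: "H \<in> T" "v \<notin> H" for G H a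
  proof
    assume aH: "a \<in> H"
    \<comment> \<open>In the link of \<open>a\<close>, this set separates the triangles through
      \<open>v\<close> from those avoiding \<open>v\<close>.\<close>
    let ?X = "\<Union>{G\<in>T. v \<in> G \<and> a \<in> G}"
    have out: "(M - {a}) \<inter> ?X = {}" if "M \<in> T" "a \<in> M" "v \<notin> M" for M
      using no_edge that by blast
    have "\<forall>M\<in>T. a \<in> M \<longrightarrow> M - {a} \<subseteq> ?X \<or> (M - {a}) \<inter> ?X = {}"
    proof (intro ballI impI)
      fix M assume "M \<in> T" "a \<in> M"
      then show "M - {a} \<subseteq> ?X \<or> (M - {a}) \<inter> ?X = {}" using out by (cases "v \<in> M") auto
    qed
    from link_connected[OF this]
    have "H - {a} \<subseteq> ?X \<or> (G - {a}) \<inter> ?X = {}" using H aH G by blast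
    moreover have "G - {a} \<subseteq> ?X" using G by auto
    ultimately show False using out[OF H(1) aH H(2)] ex_other[OF G(1), of a] ex_other[OF H(1), of a] by blast
  qed
  let ?X = "\<Union>{G\<in>T. v \<in> G}"
  have "card (F \<union> S) \<le> 7" using card_Un_le[of F S] card3 assms by simp
  then have "shells {H\<in>T. H \<subseteq> F \<union> S}" using small finite_face assms by simp
  moreover have "\<forall>H\<in>{H\<in>T. H \<subseteq> F \<union> S}. H \<subseteq> ?X \<or> H \<inter> ?X = {}"
  proof
    fix H assume "H \<in> {H\<in>T. H \<subseteq> F \<union> S}"
    then have H: "H \<in> T" by simp
    show "H \<subseteq> ?X \<or> H \<inter> ?X = {}"
    proof (cases "v \<in> H")
      case True
      then show ?thesis using H by blast
    next
      case False
      then show ?thesis using disj[OF _ _ _ H] by blast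
    qed
  qed
  ultimately have "(\<forall>H\<in>{H\<in>T. H \<subseteq> F \<union> S}. H \<subseteq> ?X) \<or> (\<forall>H\<in>{H\<in>T. H \<subseteq> F \<union> S}. H \<inter> ?X = {})"
    using shells_connected[of "{H\<in>T. H \<subseteq> F \<union> S}" ?X] card3 by simp
  then have "S \<subseteq> ?X \<or> F \<inter> ?X = {}" using assms by auto
  then have "S \<subseteq> ?X" using assms by auto
  moreover have "S \<inter> ?X = {}" using disj assms by blast
  moreover have "S \<noteq> {}" using ex_other[OF assms(1)] by blast
  ultimately show False by blast
qed

text \<open>The bound seven is reached here: \<open>v\<close> and two triangles avoiding it. A
  potential \<open>g\<close> of the cocycle is constant on triangles avoiding \<open>v\<close>,
  hence, by connectedness on \<open>Sa \<union> Sb\<close>, equal at \<open>a\<close> and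
  \<open>b\<close>; the edges from \<open>v\<close> to \<open>a\<close> and \<open>b\<close> force
  different values.\<close>

lemma no_crossing_old_edge:
  assumes respect: "\<forall>F\<in>T. v \<in> F \<and> good T v F \<longrightarrow> F - {v} \<subseteq> X \<or> (F - {v}) \<inter> X = {}"
    and vab: "{v, a, b} \<in> T" and "old T v a" "old T v b" "a \<in> X"
  shows "b \<in> X"
proof (rule ccontr)
  assume bX: "b \<notin> X"
  have dist: "a \<noteq> v" "b \<noteq> v" "a \<noteq> b" using face_distinct[OF vab] by auto
  obtain Sa where Sa: "Sa \<in> T" "v \<notin> Sa" "a \<in> Sa" using assms unfolding old_def by blast
  obtain Sb where Sb: "Sb \<in> T" "v \<notin> Sb" "b \<in> Sb" using assms unfolding old_def by blast
  let ?U = "Sa \<union> Sb"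
  let ?W = "insert v ?U"
  have finU: "finite ?U" using Sa Sb finite_face by simp
  have cU: "card ?U \<le> 6" using card_Un_le[of Sa Sb] card3 Sa Sb by simp
  have shU: "shells {F\<in>T. F \<subseteq> ?U}" using small[of ?U] finU cU by simp
  have shW: "shells {F\<in>T. F \<subseteq> ?W}"
    by (rule small) (use finU cU card_insert_le_m1[of 7 ?U v] in auto)
  txt \<open>This cochain is 1 on the edges from \<open>v\<close> into \<open>X\<close> and on the link edges crossing \<open>X\<close>; the latter
    are free, which makes it a cocycle that vanishes on all triangles avoiding \<open>v\<close>.\<close>
  define f where "f e = (if v \<in> e then e - {v} \<subseteq> X else insert v e \<in> T \<and> e \<inter> X \<noteq> {} \<and> \<not> e \<subseteq> X)" for e
  have fv: "f {v, y} = (y \<in> X)" if "y \<noteq> v" for y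
    using that unfolding f_def by auto
  have fl: "f {y, z} = ((y \<in> X) \<noteq> (z \<in> X))" if "{v, y, z} \<in> T" for y z
    using that face_distinct[OF that] unfolding f_def by auto
  \<comment> \<open>A link edge inside a triangle avoiding \<open>v\<close> makes a good triangle,
    and good triangles do not cross \<open>X\<close>.\<close>
  have f0: "\<not> f {y, z}" if "S \<in> T" "v \<notin> S" "y \<in> S" "z \<in> S" for S y z
  proof
    assume f: "f {y, z}"
    have "v \<noteq> y" "v \<noteq> z" using that by auto
    then have "{v, y, z} \<in> T" "{y, z} \<inter> X \<noteq> {}" "\<not> {y, z} \<subseteq> X"
      using f unfolding f_def by (auto split: if_splits)
    moreover have "good T v {v, y, z}" unfolding good_def using that by auto
    ultimately have "{v, y, z} - {v} \<subseteq> X \<or> ({v, y, z} - {v}) \<inter> X = {}" using respect by blast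
    then show False using \<open>{y, z} \<inter> X \<noteq> {}\<close> \<open>\<not> {y, z} \<subseteq> X\<close> \<open>v \<noteq> y\<close> \<open>v \<noteq> z\<close> by auto
  qed
  have "f {x, z} = (f {x, y} \<noteq> f {y, z})" if xyz: "{x, y, z} \<in> T" for x y z
  proof -
    have d: "x \<noteq> y" "x \<noteq> z" "y \<noteq> z" using face_distinct[OF xyz] by auto
    have perms: "{y, x, z} = {x, y, z}" "{z, x, y} = {x, y, z}" by auto
    \<comment> \<open>If \<open>v\<close> is a vertex, the equation compares membership in
      \<open>X\<close> at the two other vertices; if not, all three values vanish.\<close>
    consider "v = x" | "v = y" | "v = z" | "v \<notin> {x, y, z}" by blast
    then show ?thesis
    proof cases
      case 1
      then show ?thesis using fv[of y] fv[of z] fl[of y z] xyz d by auto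
    next
      case 2
      then show ?thesis using fv[of x] fv[of z] fl[of x z] xyz d perms by (auto simp: insert_commute)
    next
      case 3
      then show ?thesis using fv[of x] fv[of y] fl[of x y] xyz d perms by (auto simp: insert_commute)
    next
      case 4
      then show ?thesis using f0[OF xyz 4] by simp
    qed
  qed
  then have "\<exists>g :: 'a \<Rightarrow> bool. \<forall>F\<in>{F\<in>T. F \<subseteq> ?W}. \<forall>x\<in>F. \<forall>y\<in>F. x \<noteq> y \<longrightarrow> f {x, y} = (g x \<noteq> g y)"
    by (intro shells_cocycle_is_coboundary[OF shW]) (use card3 in auto)
  then obtain g :: "'a \<Rightarrow> bool" where
    g: "\<forall>F\<in>{F\<in>T. F \<subseteq> ?W}. \<forall>x\<in>F. \<forall>y\<in>F. x \<noteq> y \<longrightarrow> f {x, y} = (g x \<noteq> g y)" ..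
  have "{v, a, b} \<in> {F\<in>T. F \<subseteq> ?W}" using vab Sa Sb by auto
  from bspec[OF g this] have "f {v, a} = (g v \<noteq> g a)" "f {v, b} = (g v \<noteq> g b)"
    using dist by auto
  then have gab: "g a \<noteq> g b" using fv dist bX assms(5) by auto
  have const: "g x = g y" if "F \<in> T" "F \<subseteq> ?U" "x \<in> F" "y \<in> F" for F x y
  proof -
    have "v \<notin> F" using that Sa Sb by auto
    then have "\<not> f {x, y}" using f0 that by blast
    moreover have FW: "F \<in> {F\<in>T. F \<subseteq> ?W}" using that by auto
    ultimately show ?thesis using bspec[OF bspec[OF bspec[OF g FW] that(3)] that(4)] by auto
  qed
  have resp: "\<forall>F\<in>{F\<in>T. F \<subseteq> ?U}. F \<subseteq> {x. g x} \<or> F \<inter> {x. g x} = {}"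
    using const by blast
  have "(\<forall>F\<in>{F\<in>T. F \<subseteq> ?U}. F \<subseteq> {x. g x}) \<or> (\<forall>F\<in>{F\<in>T. F \<subseteq> ?U}. F \<inter> {x. g x} = {})"
    by (rule shells_connected[OF shU _ resp]) (use card3 in auto)
  moreover have "Sa \<in> {F\<in>T. F \<subseteq> ?U}" "Sb \<in> {F\<in>T. F \<subseteq> ?U}" using Sa Sb by auto
  ultimately show False using gab Sa(3) Sb(3) by blast
qed

section \<open>Vertices where the extension fails, and twins\<close>

text \<open>As links are connected and good triangles exist, only \<open>oldconn\<close> can fail in
  \<open>shells_extend_star\<close>. The set \<open>X\<close> witnessing this has old link vertices
  on both sides, and \<open>no_crossing_old_edge\<close> keeps every link edge, free ones included,
  from joining old vertices across it.\<close>

lemma failing_vertex: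
  assumes "\<not> shells T" "v \<in> \<Union>T"
  shows "\<exists>X. (\<exists>F\<in>T. v \<in> F \<and> (\<exists>a\<in>F - {v}. old T v a \<and> a \<in> X)) \<and>
    (\<exists>F\<in>T. v \<in> F \<and> (\<exists>b\<in>F - {v}. old T v b \<and> b \<notin> X)) \<and>
    (\<forall>F\<in>T. v \<in> F \<longrightarrow> (\<forall>y\<in>F - {v}. \<forall>z\<in>F - {v}. old T v y \<longrightarrow> old T v z \<longrightarrow> y \<in> X \<longrightarrow> z \<in> X))"
proof (rule ccontr)
  assume none: "\<not> ?thesis"
  have "shells T"
  proof (rule shells_extend_star[OF fin _ del[OF assms(2)] link_connected])
    show "\<forall>F\<in>T. card F = 3" using card3 by simp
    show "\<exists>G\<in>T. v \<in> G \<and> good T v G" if "S \<in> T" "v \<notin> S" "F \<in> T" "v \<in> F" for S F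
      using ex_good[OF that] .
    fix X
    assume X: "\<forall>F\<in>T. v \<in> F \<and> good T v F \<longrightarrow> F - {v} \<subseteq> X \<or> (F - {v}) \<inter> X = {}"
    have "z \<in> X" if "H \<in> T" "v \<in> H" "y \<in> H - {v}" "z \<in> H - {v}" "old T v y" "old T v z" "y \<in> X" for H y z
    proof (cases "y = z")
      case False
      have "H = {v, y, z}" by (rule face_eq) (use that False in auto)
      then have "{v, y, z} \<in> T" using that(1) by simp
      then show ?thesis using no_crossing_old_edge[OF X] that by simp
    qed (use that in simp)
    then have "\<forall>F\<in>T. v \<in> F \<longrightarrow> (\<forall>y\<in>F - {v}. \<forall>z\<in>F - {v}. old T v y \<longrightarrow> old T v z \<longrightarrow> y \<in> X \<longrightarrow> z \<in> X)"
      by (intro ballI impI)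
    then have both: "\<not> ((\<exists>F\<in>T. v \<in> F \<and> (\<exists>a\<in>F - {v}. old T v a \<and> a \<in> X)) \<and>
      (\<exists>F\<in>T. v \<in> F \<and> (\<exists>b\<in>F - {v}. old T v b \<and> b \<notin> X)))"
      using none by iprover
    show "(\<forall>F\<in>T. v \<in> F \<longrightarrow> (\<forall>y\<in>F - {v}. old T v y \<longrightarrow> y \<in> X)) \<or>
      (\<forall>F\<in>T. v \<in> F \<longrightarrow> (\<forall>y\<in>F - {v}. old T v y \<longrightarrow> y \<notin> X))"
    proof (cases "\<exists>F\<in>T. v \<in> F \<and> (\<exists>a\<in>F - {v}. old T v a \<and> a \<in> X)")
      case True
      then have "\<not> (\<exists>F\<in>T. v \<in> F \<and> (\<exists>b\<in>F - {v}. old T v b \<and> b \<notin> X))" using both by simp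
      then show ?thesis by simp
    next
      case False
      then show ?thesis by simp
    qed
  qed
  then show False using assms(1) by simp
qed

text \<open>If all link vertices were old, the set \<open>X\<close> of \<open>failing_vertex\<close>
  would separate the connected link of \<open>v\<close>.\<close>

lemma ex_not_old:
  assumes "\<not> shells T" "v \<in> \<Union>T"
  shows "\<exists>F\<in>T. v \<in> F \<and> (\<exists>x\<in>F - {v}. \<not> old T v x)"
proof (rule ccontr)
  assume n: "\<not> ?thesis"
  have old: "old T v x" if "F \<in> T" "v \<in> F" "x \<in> F - {v}" for F x
    using n that by blast
  obtain X where X: "\<exists>F\<in>T. v \<in> F \<and> (\<exists>a\<in>F - {v}. old T v a \<and> a \<in> X)"
    "\<exists>F\<in>T. v \<in> F \<and> (\<exists>b\<in>F - {v}. old T v b \<and> b \<notin> X)"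
    "\<forall>F\<in>T. v \<in> F \<longrightarrow> (\<forall>y\<in>F - {v}. \<forall>z\<in>F - {v}. old T v y \<longrightarrow> old T v z \<longrightarrow> y \<in> X \<longrightarrow> z \<in> X)"
    using failing_vertex[OF assms] by (elim exE conjE) (rule that)
  have "\<forall>H\<in>T. v \<in> H \<longrightarrow> H - {v} \<subseteq> X \<or> (H - {v}) \<inter> X = {}"
  proof (intro ballI impI)
    fix H assume H: "H \<in> T" "v \<in> H"
    have "z \<in> X" if "y \<in> H - {v}" "z \<in> H - {v}" "y \<in> X" for y z
      using X(3) H that old by blast
    then show "H - {v} \<subseteq> X \<or> (H - {v}) \<inter> X = {}" by blast
  qed
  from link_connected[OF this] show False using X(1,2) by blast
qed

text \<open>A vertex \<open>x\<close> that is not old for \<open>v\<close> has all its triangles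
  through \<open>v\<close>. Applying \<open>failing_vertex\<close> at \<open>x\<close> itself yields
  the converse, and an old vertex of its link serves as \<open>a\<close>.\<close>

lemma ex_twin:
  assumes "\<not> shells T" "v \<in> \<Union>T"
  shows "\<exists>x a S. x \<noteq> v \<and> (\<forall>H\<in>T. x \<in> H \<longleftrightarrow> v \<in> H) \<and> S \<in> T \<and> v \<notin> S \<and> a \<in> S \<and> {v, x, a} \<in> T"
proof -
  obtain M x where x: "M \<in> T" "v \<in> M" "x \<in> M" "x \<noteq> v" "\<not> old T v x"
    using ex_not_old[OF assms] by blast
  have xv: "v \<in> H" if "H \<in> T" "x \<in> H" for H using x(5) that unfolding old_def by blast
  have "x \<in> \<Union>T" using x by blast
  obtain X where X: "\<exists>F\<in>T. x \<in> F \<and> (\<exists>a\<in>F - {x}. old T x a \<and> a \<in> X)"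
    "\<exists>F\<in>T. x \<in> F \<and> (\<exists>b\<in>F - {x}. old T x b \<and> b \<notin> X)"
    "\<forall>F\<in>T. x \<in> F \<longrightarrow> (\<forall>y\<in>F - {x}. \<forall>z\<in>F - {x}. old T x y \<longrightarrow> old T x z \<longrightarrow> y \<in> X \<longrightarrow> z \<in> X)"
    using failing_vertex[OF assms(1) \<open>x \<in> \<Union>T\<close>] by (elim exE conjE) (rule that)
  obtain F a where F: "F \<in> T" "x \<in> F" "a \<in> F - {x}" "old T x a" "a \<in> X" using X(1) by blast
  obtain G b where G: "G \<in> T" "x \<in> G" "b \<in> G - {x}" "old T x b" "b \<notin> X" using X(2) by blast
  \<comment> \<open>In the link of \<open>x\<close>, every edge contains \<open>v\<close>. Were
    \<open>v\<close> old, the edges from \<open>a\<close> to \<open>v\<close> and from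
    \<open>v\<close> to \<open>b\<close> would carry membership in \<open>X\<close> from
    \<open>a\<close> to \<open>b\<close>.\<close>
  have nold: "\<not> old T x v"
  proof
    assume o: "old T x v"
    have vF: "v \<in> F - {x}" and vG: "v \<in> G - {x}" using xv F G x(4) by auto
    have "v \<in> X" by (rule X(3)[rule_format, OF F(1-3) vF F(4) o F(5)])
    then have "b \<in> X" by (rule X(3)[rule_format, OF G(1,2) vG G(3) o G(4)])
    then show False using G(5) by simp
  qed
  then have twin: "x \<in> H \<longleftrightarrow> v \<in> H" if "H \<in> T" for H
    using that xv unfolding old_def by blast
  obtain S where S: "S \<in> T" "x \<notin> S" "a \<in> S" using F(4) unfolding old_def by blast
  have "a \<noteq> v" using F(4) nold by auto
  then have "F = {v, x, a}" by (intro face_eq) (use F x xv in auto)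
  then have "{v, x, a} \<in> T" using F(1) by simp
  moreover have "v \<notin> S" using twin[OF S(1)] S(2) by simp
  ultimately show ?thesis using x(4) twin S by (intro exI[of _ x] exI[of _ a] exI[of _ S]) simp
qed

theorem shells_all: "shells T"
proof (rule ccontr)
  assume n: "\<not> shells T"
  then have "T \<noteq> {}" using shells_empty by auto
  then obtain v where "v \<in> \<Union>T" using ex_other by blast
  from ex_twin[OF n this] obtain x a S where
    x: "\<forall>H\<in>T. x \<in> H \<longleftrightarrow> v \<in> H" "S \<in> T" "v \<notin> S" "a \<in> S" "{v, x, a} \<in> T"
    by (elim exE conjE) (rule that)
  have "a \<in> \<Union>T" using x by blast
  from ex_twin[OF n this] obtain x' where
    x': "x' \<noteq> a" "\<forall>H\<in>T. x' \<in> H \<longleftrightarrow> a \<in> H"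
    by (elim exE conjE) (rule that)
  \<comment> \<open>A twin of \<open>a\<close> lies in both \<open>{v, x, a}\<close> and
    \<open>S\<close>, but \<open>S\<close> contains neither \<open>v\<close> nor its twin
    \<open>x\<close>.\<close>
  have "x' \<in> {v, x}" using bspec[OF x'(2) x(5)] x'(1) by auto
  moreover have "x' \<in> S" using bspec[OF x'(2) x(2)] x(4) by simp
  ultimately show False using bspec[OF x(1,2)] x(3) by auto
qed

end

section \<open>Nonpure complexes\<close>

lemma simplicial_complexD:
  assumes "simplicial_complex V K"
  shows "finite V" "finite K" "F \<in> K \<Longrightarrow> F \<subseteq> V" "F \<in> K \<Longrightarrow> finite F" "F \<in> K \<Longrightarrow> G \<subseteq> F \<Longrightarrow> G \<in> K"
  using assms unfolding simplicial_complex_def by (auto intro: finite_subset)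

text \<open>Faces have at most three points, so the triangles inside \<open>U\<close> are exactly
  the facets of top size, and \<open>shells_top_dimensional\<close> extracts them from a nonpure
  shelling.\<close>

lemma shells_induced_triangles:
  assumes "\<forall>F\<in>K. finite F \<and> card F \<le> 3" "shellable (induced_subcomplex K U)"
  shows "shells {F\<in>{F\<in>K. card F = 3}. F \<subseteq> U}"
proof -
  let ?L = "induced_subcomplex K U"
  have "shells {F\<in>facets ?L. card F = Suc 2}"
  proof (rule shells_top_dimensional)
    show "shells (facets ?L)"
      using assms shellable_iff_shells[of ?L] unfolding induced_subcomplex_def by auto
    show "\<forall>F\<in>facets ?L. finite F \<and> card F \<le> Suc 2"
      using assms(1) unfolding facets_def induced_subcomplex_def by auto
    show "\<forall>F\<in>facets ?L. \<forall>G\<in>facets ?L. F \<subseteq> G \<longrightarrow> F = G"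
      unfolding facets_def by auto
  qed
  moreover have "G = F" if "F \<in> K" "card F = 3" "G \<in> K" "F \<subseteq> G" for F G
    using card_seteq[of G F] assms(1) that by auto
  then have "{F\<in>facets ?L. card F = Suc 2} = {F\<in>{F\<in>K. card F = 3}. F \<subseteq> U}"
    unfolding facets_def induced_subcomplex_def by auto
  ultimately show ?thesis by simp
qed

text \<open>The two edges are the only facets, and \<open>e\<close> as the separating set
  contradicts \<open>shells_connected\<close>.\<close>

lemma induced_two_edges_not_shellable:
  assumes K: "simplicial_complex V K" and e: "e \<in> K" "e' \<in> K" "card e = 2" "card e' = 2" "e \<inter> e' = {}"
    and cross: "\<And>G. G \<in> K \<Longrightarrow> G \<subseteq> e \<union> e' \<Longrightarrow> G \<subseteq> e \<or> G \<subseteq> e'"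
  shows "\<not> shellable (induced_subcomplex K (e \<union> e'))"
proof
  let ?L = "induced_subcomplex K (e \<union> e')"
  assume "shellable ?L"
  then have sh: "shells (facets ?L)"
    using shellable_iff_shells[of ?L] simplicial_complexD(4)[OF K] unfolding induced_subcomplex_def by auto
  have ne: "e \<noteq> {}" "e' \<noteq> {}" using e by auto
  have fac: "F = e \<or> F = e'" if "F \<in> facets ?L" for F
  proof -
    have F: "F \<in> K" "F \<subseteq> e \<union> e'" "\<And>G. G \<in> ?L \<Longrightarrow> F \<subseteq> G \<Longrightarrow> G = F"
      using that unfolding facets_def by (auto simp: induced_subcomplex_def)
    have "e \<in> ?L" "e' \<in> ?L" using e unfolding induced_subcomplex_def by auto
    then show ?thesis using cross[OF F(1,2)] F(3) by blast
  qed
  have "e \<in> facets ?L" "e' \<in> facets ?L"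
  proof -
    have "G = e" if "G \<in> K" "G \<subseteq> e \<union> e'" "e \<subseteq> G" for G using cross[OF that(1,2)] that(3) e(5) ne by blast
    moreover have "G = e'" if "G \<in> K" "G \<subseteq> e \<union> e'" "e' \<subseteq> G" for G
      using cross[OF that(1,2)] that(3) e(5) ne by blast
    ultimately show "e \<in> facets ?L" "e' \<in> facets ?L"
      using e(1,2) unfolding facets_def induced_subcomplex_def by auto
  qed
  moreover have "(\<forall>F\<in>facets ?L. F \<subseteq> e) \<or> (\<forall>F\<in>facets ?L. F \<inter> e = {})"
  proof (rule shells_connected[OF sh]; intro ballI)
    fix F assume "F \<in> facets ?L"
    then show "2 \<le> card F" "F \<subseteq> e \<or> F \<inter> e = {}" using fac[of F] e(3-5) by auto
  qed
  ultimately show False using ne e(5) by blast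
qed

lemma attaches_point:
  assumes "card F = 1" "\<And>H. H \<in> A \<Longrightarrow> \<not> F \<subseteq> H"
  shows "attaches A F"
proof -
  obtain v where "F = {v}" using assms(1) by (auto simp: card_1_singleton_iff)
  then have "H \<inter> F = {}" if "H \<in> A" for H using assms(2)[OF that] by auto
  then show ?thesis using assms(1) unfolding attaches_def by auto
qed

lemma attaches_edge:
  assumes "card F = 2" "\<And>H. H \<in> A \<Longrightarrow> \<not> F \<subseteq> H" "M \<in> A" "M \<inter> F \<noteq> {}"
  shows "attaches A F"
proof -
  obtain c d where F: "F = {c, d}" "c \<noteq> d" using assms(1) by (auto simp: card_2_iff)
  have "H \<inter> F = {} \<or> card (H \<inter> F) = 1" if "H \<in> A" for H
    using assms(2)[OF that] F by (cases "c \<in> H"; cases "d \<in> H") auto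
  then show ?thesis unfolding attaches_def using assms(1,3,4)
    by (metis Suc_1 Suc_eq_plus1 empty_subsetI inf_le1)
qed

theorem theorem3:
  fixes V :: "'a set" and K :: "'a set set"
  assumes "simplicial_complex V K"
    and "complex_dim K = 2"
    and "obstruction_to_shellability V K"
  shows "card V \<le> 7"
proof (rule ccontr)
  assume "\<not> card V \<le> 7"
  then have V8: "8 \<le> card V" by simp
  note K = simplicial_complexD[OF assms(1)]
  have ind: "shellable (induced_subcomplex K U)" if "U \<subset> V" for U
    using assms(3) that unfolding obstruction_to_shellability_def by simp
  have small_ind: "shellable (induced_subcomplex K U)" if "finite U" "card U \<le> 7" "U \<subseteq> V" for U
    using ind[of U] that V8 by force
  have le3: "card F \<le> 3" if "F \<in> K" for F
  proof -
    have "face_dim F \<le> complex_dim K" unfolding complex_dim_def using K(2) that by simp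
    then show ?thesis using assms(2) unfolding face_dim_def by simp
  qed
  have "K \<noteq> {}" using assms(1) unfolding simplicial_complex_def by auto
  then have "complex_dim K \<in> face_dim ` K" unfolding complex_dim_def using K(2) by (intro Max_in) auto
  then obtain t where t: "t \<in> K" "card t = 3" using assms(2) unfolding face_dim_def by auto
  define T where "T = {F\<in>K. card F = 3}"
  have tri: "shells {F\<in>T. F \<subseteq> U}" if "shellable (induced_subcomplex K U)" for U
    unfolding T_def by (rule shells_induced_triangles) (use that le3 K(4) in auto)
  interpret locally_shellable T
  proof
    show "finite T" unfolding T_def using K(2) by simp
    show "card F = 3" if "F \<in> T" for F using that unfolding T_def by simp
    show "shells {F\<in>T. F \<subseteq> U}" if "finite U" "card U \<le> 7" for U
    proof -
      \<comment> \<open>The locale allows \<open>U\<close> to leave the vertex set, so it is first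
        cut down to \<open>V\<close>.\<close>
      have "card (U \<inter> V) \<le> 7" using that card_mono[of U "U \<inter> V"] by auto
      then have "shells {F\<in>T. F \<subseteq> U \<inter> V}" using that by (intro tri small_ind) auto
      moreover have "{F\<in>T. F \<subseteq> U \<inter> V} = {F\<in>T. F \<subseteq> U}" using K(3) unfolding T_def by auto
      ultimately show ?thesis by simp
    qed
    show "shells {F\<in>T. v \<notin> F}" if "v \<in> \<Union>T" for v
    proof -
      have "v \<in> V" using that K(3) unfolding T_def by auto
      then have "shells {F\<in>T. F \<subseteq> V - {v}}" by (intro tri ind) auto
      moreover have "{F\<in>T. F \<subseteq> V - {v}} = {F\<in>T. v \<notin> F}" using K(3) unfolding T_def by auto
      ultimately show ?thesis by simp
    qed
  qed
  have Tfac: "T \<subseteq> facets K"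
  proof
    fix F assume F: "F \<in> T"
    have "G = F" if "G \<in> K" "F \<subseteq> G" for G
      using card_seteq[of G F] le3[OF that(1)] K(4)[OF that(1)] that(2) F unfolding T_def by auto
    then show "F \<in> facets K" using F unfolding facets_def T_def by auto
  qed
  have finfac: "finite (facets K)" using K(2) unfolding facets_def by simp
  \<comment> \<open>With all triangles placed, the remaining facets are added greedily. A point
    always attaches and an edge does once it touches a placed facet, so a leftover facet is an edge
    disjoint from everything placed.\<close>
  obtain C where C: "C \<subseteq> facets K" "shells (T \<union> C)"
    "\<And>F. F \<in> facets K \<Longrightarrow> F \<notin> T \<union> C \<Longrightarrow> \<not> attaches (T \<union> C) F"
    using obtain_maximal_shells[of "facets K" T "{}"] finfac shells_all by auto
  have antichain: "\<not> F \<subseteq> H" if "F \<in> facets K" "F \<notin> T \<union> C" "H \<in> T \<union> C" for F H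
    using that C(1) Tfac unfolding facets_def by blast
  have edge: "card F = 2" and avoid: "\<And>H. H \<in> T \<union> C \<Longrightarrow> H \<inter> F = {}"
    if F: "F \<in> facets K" "F \<notin> T \<union> C" for F
  proof -
    have FK: "F \<in> K" using F unfolding facets_def by simp
    have "F \<noteq> {}" using F t unfolding facets_def by auto
    then have "card F \<noteq> 0" using K(4)[OF FK] by simp
    moreover have "card F \<noteq> 1" using attaches_point[of F "T \<union> C"] antichain[OF F] C(3)[OF F] by blast
    moreover have "card F \<noteq> 3" using FK F unfolding T_def by auto
    ultimately show c2: "card F = 2" using le3[OF FK] by linarith
    show "H \<inter> F = {}" if "H \<in> T \<union> C" for H
      using attaches_edge[OF c2 antichain[OF F] that] C(3)[OF F] by blast
  qed
  have "T \<union> C = facets K"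
  proof (rule ccontr)
    assume "T \<union> C \<noteq> facets K"
    then obtain F where F: "F \<in> facets K" "F \<notin> T \<union> C" using C(1) Tfac by blast
    have FK: "F \<in> K" using F unfolding facets_def by simp
    have tT: "t \<in> T" using t unfolding T_def by simp
    \<comment> \<open>An edge \<open>e\<close> of the triangle \<open>t\<close> and the leftover
      \<open>F\<close> span at most four vertices, so some face \<open>G\<close> joins them. A facet
      above \<open>G\<close> meets \<open>F\<close>, hence is not placed, and meets
      \<open>t\<close>, hence is not left over.\<close>
    obtain e where e: "e \<subseteq> t" "card e = 2" using obtain_subset_with_card_n[of 2 t] t by auto
    have eK: "e \<in> K" using K(5)[OF t(1) e(1)] .
    have disj: "e \<inter> F = {}" using avoid[OF F, of t] tT e(1) by blast
    have "card (e \<union> F) \<le> 7" using card_Un_le[of e F] e(2) edge[OF F] by simp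
    then have "shellable (induced_subcomplex K (e \<union> F))"
      using small_ind[of "e \<union> F"] K(3,4) eK FK by simp
    then obtain G where G: "G \<in> K" "G \<subseteq> e \<union> F" "\<not> G \<subseteq> e" "\<not> G \<subseteq> F"
      using induced_two_edges_not_shellable[OF assms(1) eK FK e(2) edge[OF F] disj] by blast
    obtain M where M: "M \<in> facets K" "G \<subseteq> M" using ex_facet_above[OF K(2) G(1)] by blast
    have "M \<inter> F \<noteq> {}" "t \<inter> M \<noteq> {}" using G M e(1) by blast+
    then have "M \<notin> T \<union> C" using avoid[OF F, of M] by blast
    then show False using avoid[OF M(1), of t] tT \<open>t \<inter> M \<noteq> {}\<close> by simp
  qed
  then have "shells (facets K)" using C(2) by simp
  then have "shellable K" using shellable_iff_shells[of K] K(4) by simp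
  then show False using assms(3) unfolding obstruction_to_shellability_def by simp
qed

end
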